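(* For every integer $n\ge 2$, $\psi_{sq}(K_n)=2$.
   Context: $K_n$ is the complete graph on $n$ vertices. $N_G[v]$ denotes the closed neighborhood of $v$ in a finite simple graph $G$. A sub-quorum coloring of $G$ with $k$ colors is an onto partial map $f:V(G)\dashrightarrow\{1,\ldots,k\}$ such that, with $S=\operatorname{dom}(f)$, every $v\in S$ satisfies $|\{u\in N_G[v]\cap S: f(u)=f(v)\}|\ge\frac12|N_G[v]\cap S|$; $\psi_{sq}(G)$ is the maximum such $k$. *)

theory Defs
  imports Complex_Main "Graph_Theory.Kuratowski"
begin

text \<open>
  Finite simple graphs are the graphs of locale \<open>graph\<close>, that is, finite symmetric digraphs without
  loops or parallel arcs; every undirected edge is a pair of opposite arcs. \<open>K_n\<close> is
  \<open>complete_digraph n\<close>, a predicate on graphs.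
\<close>

definition closed_nbhd :: "('a, 'b) pre_digraph \<Rightarrow> 'a \<Rightarrow> 'a set" where
  "closed_nbhd G v = insert v {u \<in> verts G. v \<rightarrow>\<^bsub>G\<^esub> u}"

definition sub_quorum_coloring :: "('a, 'b) pre_digraph \<Rightarrow> nat \<Rightarrow> ('a \<rightharpoonup> nat) \<Rightarrow> bool" where
  "sub_quorum_coloring G k f \<longleftrightarrow>
     dom f \<subseteq> verts G \<and> ran f = {1..k} \<and>
     (\<forall>v \<in> dom f. real (card {u \<in> closed_nbhd G v \<inter> dom f. f u = f v})
                   \<ge> 1/2 * real (card (closed_nbhd G v \<inter> dom f)))"

definition psi_sq :: "('a, 'b) pre_digraph \<Rightarrow> nat" where
  "psi_sq G = Max {k. \<exists>f. sub_quorum_coloring G k f}"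

text \<open>
  For graphs with finitely many vertices, the maximum is taken over a finite nonempty set.
  Note that the empty map is a colouring with 0 colours.
\<close>

lemma sub_quorum_coloring_empty: "sub_quorum_coloring G 0 Map.empty"
  by (simp add: sub_quorum_coloring_def)

lemma sub_quorum_coloring_le_card:
  assumes "finite (verts G)" "sub_quorum_coloring G k f"
  shows "k \<le> card (verts G)"
proof -
  have fin: "finite (dom f)" and sub: "dom f \<subseteq> verts G" and r: "ran f = {1..k}"
    using assms finite_subset by (auto simp: sub_quorum_coloring_def)
  have "{1..k} \<subseteq> (\<lambda>x. the (f x)) ` dom f"
    unfolding r[symmetric] ran_def by force
  then have "card {1..k} \<le> card (dom f)"
    using fin surj_card_le by blast
  also have "\<dots> \<le> card (verts G)"
    using assms(1) sub by (rule card_mono)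
  finally show ?thesis by simp
qed

lemma finite_sub_quorum_numbers:
  assumes "finite (verts G)"
  shows "finite {k. \<exists>f. sub_quorum_coloring G k f}"
  by (rule finite_subset[of _ "{..card (verts G)}"])
     (use assms sub_quorum_coloring_le_card in auto)

end

theory Submission
  imports Defs
begin

text \<open>
  In a complete graph all closed neighborhoods are the whole vertex set, so in a sub-quorum coloring
  with domain \<open>S\<close> every vertex of \<open>S\<close> demands that its own color class contain at least half of \<open>S\<close>.
  The \<open>k\<close> color classes are nonempty and partition \<open>S\<close>; adding up their sizes gives
  \<open>k * card S / 2 \<le> card S\<close>, whence \<open>k \<le> 2\<close>
  (lemma \<open>sub_quorum_coloring_dominating_le_2\<close>).
  Two colors suffice on two vertices: color one vertex with 1, another with 2, and leave all others
  uncolored. Each class is then exactly half of the domain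
  (lemma \<open>sub_quorum_coloring_two_vertices\<close>).
\<close>

lemma closed_nbhd_complete_digraph:
  assumes "complete_digraph n G" "v \<in> verts G"
  shows "closed_nbhd G v = verts G"
  using assms by (auto simp: complete_digraph_def closed_nbhd_def)

text \<open>
  If every colored vertex sees the whole domain, the majority condition at a vertex of color \<open>c\<close> says
  that class \<open>c\<close> fills at least half of the domain, and disjoint nonempty classes of that size
  number at most two.
\<close>

lemma sub_quorum_coloring_dominating_le_2:
  assumes col: "sub_quorum_coloring G k f"
    and fin: "finite (dom f)"
    and sees_dom: "\<And>v. v \<in> dom f \<Longrightarrow> dom f \<subseteq> closed_nbhd G v"
  shows "k \<le> 2"
proof (cases "k = 0")
  case False
  define A where "A c = {u \<in> dom f. f u = Some c}" for c
  have ran: "ran f = {1..k}"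
    using col by (simp add: sub_quorum_coloring_def)
  have half: "real (card (A c)) \<ge> 1/2 * real (card (dom f))" if c: "c \<in> {1..k}" for c
  proof -
    obtain v where v: "f v = Some c"
      using c unfolding ran[symmetric] ran_def by blast
    then have vdom: "v \<in> dom f" by auto
    then have seen: "closed_nbhd G v \<inter> dom f = dom f"
      using sees_dom by blast
    have "real (card {u \<in> closed_nbhd G v \<inter> dom f. f u = f v})
            \<ge> 1/2 * real (card (closed_nbhd G v \<inter> dom f))"
      using col vdom unfolding sub_quorum_coloring_def by blast
    then show ?thesis
      unfolding seen v A_def .
  qed
  have "(\<Union>c\<in>{1..k}. A c) = dom f"
    unfolding ran[symmetric] A_def by (auto simp: ran_def)
  moreover have "card (\<Union>c\<in>{1..k}. A c) = (\<Sum>c\<in>{1..k}. card (A c))"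
    by (rule card_UN_disjoint) (use fin in \<open>auto simp: A_def\<close>)
  ultimately have "real (card (dom f)) = (\<Sum>c\<in>{1..k}. real (card (A c)))"
    by simp
  also have "\<dots> \<ge> (\<Sum>c\<in>{1..k}. 1/2 * real (card (dom f)))"
    by (rule sum_mono) (rule half)
  finally have "real k * real (card (dom f)) \<le> 2 * real (card (dom f))"
    by simp
  moreover have "dom f \<noteq> {}"
    using False ran by auto
  then have "real (card (dom f)) > 0"
    using fin by (simp add: card_gt_0_iff)
  ultimately show ?thesis
    by simp
qed simp

text \<open>
  Each color class is a single vertex, and a vertex always lies in its own closed neighborhood; it is
  at least half of the at most two colored vertices there.
\<close>

lemma sub_quorum_coloring_two_vertices:
  assumes ab: "a \<in> verts G" "b \<in> verts G" "a \<noteq> b"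
  shows "sub_quorum_coloring G 2 [a \<mapsto> 1, b \<mapsto> 2]"
proof -
  let ?f = "[a \<mapsto> 1, b \<mapsto> 2] :: 'a \<rightharpoonup> nat"
  have dom: "dom ?f = {a, b}"
    by auto
  have "{1..2} = {1, 2::nat}"
    by auto
  then have ran: "ran ?f = {1..2}"
    using ab by auto
  have "real (card {u \<in> closed_nbhd G v \<inter> {a, b}. ?f u = ?f v})
          \<ge> 1/2 * real (card (closed_nbhd G v \<inter> {a, b}))" if v: "v \<in> {a, b}" for v
  proof -
    have "{u \<in> closed_nbhd G v \<inter> {a, b}. ?f u = ?f v} = {v}"
      using v ab by (auto simp: closed_nbhd_def)
    moreover have "card (closed_nbhd G v \<inter> {a, b}) \<le> card {a, b}"
      by (rule card_mono) auto
    ultimately show ?thesis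
      using ab by simp
  qed
  then show ?thesis
    using ab ran unfolding sub_quorum_coloring_def dom by blast
qed

theorem proposition5p9:
  fixes n :: nat and G :: "('a, 'b) pre_digraph"
  assumes "n \<ge> 2"
    and "complete_digraph n G"
  shows "psi_sq G = 2"
proof -
  have card: "card (verts G) \<ge> 2"
    using assms by (simp add: complete_digraph_def)
  then have fin: "finite (verts G)"
    using card.infinite by fastforce
  have "\<not> (\<forall>a \<in> verts G. \<forall>b \<in> verts G. a = b)"
    using card card_le_Suc0_iff_eq[OF fin] by linarith
  then obtain a b where "a \<in> verts G" "b \<in> verts G" "a \<noteq> b"
    by blast
  then have two: "\<exists>f. sub_quorum_coloring G 2 f"
    by (intro exI) (rule sub_quorum_coloring_two_vertices)
  have le: "k \<le> 2" if col: "sub_quorum_coloring G k f" for k f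
  proof (rule sub_quorum_coloring_dominating_le_2[OF col])
    have sub: "dom f \<subseteq> verts G"
      using col by (simp add: sub_quorum_coloring_def)
    then show "finite (dom f)"
      using fin by (rule finite_subset)
    show "dom f \<subseteq> closed_nbhd G v" if "v \<in> dom f" for v
    proof -
      have "closed_nbhd G v = verts G"
        by (rule closed_nbhd_complete_digraph[OF assms(2)]) (use sub that in blast)
      then show ?thesis
        using sub by simp
    qed
  qed
  show ?thesis
    unfolding psi_sq_def
    by (rule Max_eqI) (use finite_sub_quorum_numbers[OF fin] two le in auto)
qed

end
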